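(* Let $t\in[0,1)$. Then $C_t(H^\infty)\subseteq A(\mathbb{D})$.
   Context: Let $\mathbb{D}=\{z\in\mathbb{C}:|z|<1\}$ and let $H(\mathbb{D})$ be the space of holomorphic functions on $\mathbb{D}$. $H^\infty$ is the space of bounded $f\in H(\mathbb{D})$, and the disc algebra $A(\mathbb{D})$ is the space of all $f\in H(\mathbb{D})$ that extend to a continuous function on $\overline{\mathbb{D}}$. For $t\in[0,1)$ the generalized Cesàro operator $C_t\colon H(\mathbb{D})\to H(\mathbb{D})$ is defined by $(C_tf)(0):=f(0)$ and $(C_tf)(z):=\frac1z\int_0^z\frac{f(\xi)}{1-t\xi}\,d\xi$ for $z\in\mathbb{D}\setminus\{0\}$. *)

theory Defs
  imports "HOL-Complex_Analysis.Complex_Analysis"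
begin

abbreviation unit_disc :: "complex set" where
  "unit_disc \<equiv> ball 0 1"

(* Functions on the disc are total functions complex => complex whose values outside
   the open disc are irrelevant: every notion below depends on f only through its
   restriction to unit_disc. *)

definition hol_disc :: "(complex \<Rightarrow> complex) set" where
  "hol_disc = {f. f holomorphic_on unit_disc}"

definition H_infty :: "(complex \<Rightarrow> complex) set" where
  "H_infty = {f \<in> hol_disc. bounded (f ` unit_disc)}"

(* The extension g is separate from f, since the values of f on the unit circle
   carry no meaning. *)
definition disc_algebra :: "(complex \<Rightarrow> complex) set" where
  "disc_algebra = {f \<in> hol_disc.
     \<exists>g. continuous_on (closure unit_disc) g \<and> (\<forall>z\<in>unit_disc. g z = f z)}"

(* The integral from 0 to z is taken along the straight segment; for z in the disc and
   f holomorphic there it does not depend on the path within the disc. *)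
definition cesaro :: "real \<Rightarrow> (complex \<Rightarrow> complex) \<Rightarrow> complex \<Rightarrow> complex" where
  "cesaro t f z =
     (if z = 0 then f 0
      else 1 / z * contour_integral (linepath 0 z) (\<lambda>\<xi>. f \<xi> / (1 - of_real t * \<xi>)))"

end

theory Submission
  imports Defs
begin

text \<open>
  Fix a bounded holomorphic \<open>f\<close> and put \<open>h \<xi> = f \<xi> / (1 - t \<xi>)\<close>. Because \<open>t < 1\<close>, the singularity
  of the kernel lies outside the closed disc, so \<open>\<bar>1 - t \<xi>\<bar> \<ge> 1 - t > 0\<close> on the disc and \<open>h\<close> is
  again bounded and holomorphic. A primitive \<open>F\<close> of \<open>h\<close> therefore has bounded derivative on a convex
  set, so it is Lipschitz, hence uniformly continuous, and extends continuously to the closed disc.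
  Normalising \<open>F 0 = 0\<close>, the operator is \<open>F z / z\<close> with the singularity at \<open>0\<close> removed by the
  value \<open>F' 0 = h 0 = f 0\<close>. Division by \<open>z\<close> does not affect the continuous extension away from
  the origin, and near the origin the function is holomorphic anyway.
\<close>

text \<open>
  The Lipschitz estimate along segments makes a primitive of a bounded function uniformly continuous,
  which is what lets it pass to the closure.
\<close>

lemma bounded_derivative_extends_to_closure:
  fixes F :: "complex \<Rightarrow> complex"
  assumes "convex S"
    and deriv: "\<And>z. z \<in> S \<Longrightarrow> (F has_field_derivative h z) (at z within S)"
    and bdd: "bounded (h ` S)"
  obtains G where "continuous_on (closure S) G" "\<And>z. z \<in> S \<Longrightarrow> G z = F z"
proof -
  obtain B where B: "B > 0" "\<And>z. z \<in> S \<Longrightarrow> norm (h z) \<le> B"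
    using bdd by (auto simp: bounded_pos)
  have "B-lipschitz_on S F"
  proof (rule lipschitz_onI)
    show "dist (F x) (F y) \<le> B * dist x y" if "x \<in> S" "y \<in> S" for x y
      using field_differentiable_bound[OF \<open>convex S\<close> deriv B(2) that] by (simp add: dist_norm)
  qed (use B in simp)
  then have "uniformly_continuous_on S F"
    by (rule lipschitz_on_uniformly_continuous)
  then show thesis
    by (metis uniformly_continuous_imp_continuous uniformly_continuous_on_extension_on_closure that)
qed

lemma cesaro_kernel_bound:
  assumes "t \<in> {0..<1}" "\<xi> \<in> unit_disc"
  shows "norm (1 - of_real t * \<xi>) \<ge> 1 - t"
proof -
  have "norm (of_real t * \<xi>) \<le> t"
    using assms by (auto simp: norm_mult intro: mult_left_le)
  then show ?thesis
    using norm_triangle_ineq2[of 1 "of_real t * \<xi>"] by simp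
qed

lemma cesaro_integrand_bounded:
  assumes t: "t \<in> {0..<1}" and "bounded (f ` unit_disc)"
  shows "bounded ((\<lambda>\<xi>. f \<xi> / (1 - of_real t * \<xi>)) ` unit_disc)"
proof -
  obtain M where M: "M > 0" "\<And>z. z \<in> unit_disc \<Longrightarrow> norm (f z) \<le> M"
    using assms(2) by (auto simp: bounded_pos)
  have "norm (f \<xi> / (1 - of_real t * \<xi>)) \<le> M / (1 - t)" if "\<xi> \<in> unit_disc" for \<xi>
    using t M(1) M(2)[OF that] cesaro_kernel_bound[OF t that]
    unfolding norm_divide by (intro frac_le) auto
  then show ?thesis
    unfolding bounded_iff by blast
qed

lemma cesaro_integrand_holomorphic:
  assumes t: "t \<in> {0..<1}" and "f holomorphic_on unit_disc"
  shows "(\<lambda>\<xi>. f \<xi> / (1 - of_real t * \<xi>)) holomorphic_on unit_disc"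
proof -
  have "1 - of_real t * \<xi> \<noteq> 0" if "\<xi> \<in> unit_disc" for \<xi>
    using cesaro_kernel_bound[OF t that] t by auto
  then show ?thesis
    using assms(2) by (intro holomorphic_intros) auto
qed

lemma cesaro_eq_primitive_quotient:
  assumes deriv: "\<And>z. z \<in> unit_disc \<Longrightarrow>
      (F has_field_derivative f z / (1 - of_real t * z)) (at z within unit_disc)"
    and "F 0 = 0" "z \<in> unit_disc" "z \<noteq> 0"
  shows "cesaro t f z = F z / z"
proof -
  have "closed_segment 0 z \<subseteq> unit_disc"
    using assms(3) by (intro closed_segment_subset) auto
  then have "((\<lambda>\<xi>. f \<xi> / (1 - of_real t * \<xi>)) has_contour_integral
      F (pathfinish (linepath 0 z)) - F (pathstart (linepath 0 z))) (linepath 0 z)"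
    by (intro contour_integral_primitive[OF deriv]) auto
  then have "contour_integral (linepath 0 z) (\<lambda>\<xi>. f \<xi> / (1 - of_real t * \<xi>)) = F z"
    using \<open>F 0 = 0\<close> by (simp add: contour_integral_unique)
  then show ?thesis
    using \<open>z \<noteq> 0\<close> by (simp add: cesaro_def)
qed

theorem proposition3p10:
  fixes t :: real
  assumes "t \<in> {0..<1}"
  shows "cesaro t ` H_infty \<subseteq> disc_algebra"
proof (rule image_subsetI)
  fix f
  assume "f \<in> H_infty"
  then have hol: "f holomorphic_on unit_disc" and bdd: "bounded (f ` unit_disc)"
    by (auto simp: H_infty_def hol_disc_def)
  define h where "h = (\<lambda>\<xi>. f \<xi> / (1 - of_real t * \<xi>))"
  obtain F0 where F0: "\<And>z. z \<in> unit_disc \<Longrightarrow> (F0 has_field_derivative h z) (at z within unit_disc)"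
    using holomorphic_convex_primitive'[OF convex_ball open_ball
        cesaro_integrand_holomorphic[OF assms hol]] unfolding h_def by metis
  define F where "F = (\<lambda>z. F0 z - F0 0)"
  have F_zero: "F 0 = 0"
    and F: "\<And>z. z \<in> unit_disc \<Longrightarrow> (F has_field_derivative h z) (at z within unit_disc)"
    using F0 by (auto simp: F_def intro!: derivative_eq_intros)
  have quotient: "cesaro t f z = F z / z" if "z \<in> unit_disc" "z \<noteq> 0" for z
    using cesaro_eq_primitive_quotient[OF F[unfolded h_def] F_zero] that by simp
  have "(F has_field_derivative h 0) (at 0)"
    using F[of 0] by (simp add: at_within_open[of 0 unit_disc])
  then have deriv0: "cesaro t f 0 = deriv F 0"
    by (simp add: DERIV_imp_deriv cesaro_def h_def)
  have "F holomorphic_on unit_disc"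
    unfolding holomorphic_on_def field_differentiable_def using F by blast
  then have hol_cesaro: "cesaro t f holomorphic_on unit_disc"
    by (rule pole_theorem_open_0[where a = 0]) (use quotient deriv0 F_zero in auto)
  obtain G where G: "continuous_on (closure unit_disc) G" "\<And>z. z \<in> unit_disc \<Longrightarrow> G z = F z"
    using bounded_derivative_extends_to_closure[OF convex_ball F]
      cesaro_integrand_bounded[OF assms bdd] unfolding h_def by blast
  define g where "g = (\<lambda>z. if z = 0 then f 0 else G z / z)"
  have g_eq: "g z = cesaro t f z" if "z \<in> unit_disc" for z
    using that G(2) quotient by (auto simp: g_def cesaro_def)
  \<comment> \<open>The disc and the punctured closed disc form a cover of the closed disc by relatively open
    sets; continuity of the extension is clear on each of the two.\<close>
  have "continuous_on unit_disc g"
    by (rule continuous_on_eq[OF holomorphic_on_imp_continuous_on[OF hol_cesaro]])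
      (rule g_eq[symmetric])
  moreover have "continuous_on (cball 0 1 - {0}) (\<lambda>z. G z / z)"
    using G(1) by (intro continuous_intros) (auto intro: continuous_on_subset)
  then have "continuous_on (cball 0 1 - {0}) g"
    by (rule continuous_on_eq) (auto simp: g_def)
  moreover have cover: "unit_disc \<union> (cball 0 1 - {0}) = cball 0 1"
    by auto
  ultimately have "continuous_on (unit_disc \<union> (cball 0 1 - {0})) g"
    by (intro continuous_on_Un_local_open)
      (simp_all add: cover openin_delete open_subset)
  then have "continuous_on (closure unit_disc) g"
    by (simp add: cover)
  then show "cesaro t f \<in> disc_algebra"
    using hol_cesaro g_eq by (auto simp: disc_algebra_def hol_disc_def)
qed

end
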